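(* Let $n,p\in\mathbb N$, let $\lambda\ge\mu\ge 0$, $l\ge 0$ be real, let $-1\le A<B\le 1$, $0<B\le 1$ and $0\le\sigma<p$. If $\left[\lambda-\mu\ge \frac{l+p}{2p}\ \text{ or }\ \lambda=\mu=0\right]$ and $\delta\ge 0$, then $$\mathcal P_{\lambda,\mu,l}^{\delta+1}(A,B;\sigma,p)\subseteq \mathcal P_{\lambda,\mu,l}^{\delta}(A,B;\sigma,p).$$
   Context: $\mathbb N=\{1,2,3,\dots\}$ and $\mathcal U=\{z\in\mathbb C:|z|<1\}$. $\mathcal A(n,p)$ is the class of functions $f(z)=z^p+\sum_{k=n+p}^\infty a_kz^k$ that are analytic and $p$-valent in $\mathcal U$ ($p$-valent: no value is taken more than $p$ times in $\mathcal U$, counted with multiplicity, and some value is taken exactly $p$ times). For real $\delta\ge0$ and $k\ge n+p$ put $$\Phi_p^k(\delta,\lambda,\mu,l)=\left[\frac{(k-p)(\lambda\mu k+\lambda-\mu)+p+l}{p+l}\right]^{\delta},\qquad \mathcal J_p^\delta(\lambda,\mu,l)f(z)=z^p+\sum_{k=n+p}^\infty\Phi_p^k(\delta,\lambda,\mu,l)\,a_kz^k .$$ For $F,G$ analytic in $\mathcal U$, $F\prec G$ (subordination) means $F(z)=G(w(z))$ in $\mathcal U$ for some analytic $w:\mathcal U\to\mathbb C$ with $w(0)=0$, $|w(z)|<1$. For every real $\delta\ge 0$, $\mathcal P_{\lambda,\mu,l}^{\delta}(A,B;\sigma,p)$ is the class of all $f\in\mathcal A(n,p)$ with $$\frac1{p-\sigma}\left(\frac{[\mathcal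 J_p^\delta(\lambda,\mu,l)f(z)]'}{z^{p-1}}-\sigma\right)\prec\frac{1+Az}{1+Bz}\quad(z\in\mathcal U)$$ (the quotient by $z^{p-1}$ being extended analytically to $z=0$). *)

theory Defs
  imports "HOL-Complex_Analysis.Complex_Analysis"
begin

abbreviation unit_disc :: "complex set" where
  "unit_disc \<equiv> ball 0 1"

text \<open>
  Values are counted with multiplicity through \<^const>\<open>zorder\<close>. Finiteness of the fibres is
  stated explicitly because a sum over an infinite set is \<open>0\<close>; it also rules out constant
  functions, for which \<^const>\<open>zorder\<close> would not be meaningful.
\<close>

definition p_valent :: "nat \<Rightarrow> (complex \<Rightarrow> complex) \<Rightarrow> bool" where
  "p_valent p f \<longleftrightarrow>
     (\<forall>w. finite {z \<in> unit_disc. f z = w} \<and>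
          (\<Sum>z \<in> {z \<in> unit_disc. f z = w}. zorder (\<lambda>u. f u - w) z) \<le> int p) \<and>
     (\<exists>w. (\<Sum>z \<in> {z \<in> unit_disc. f z = w}. zorder (\<lambda>u. f u - w) z) = int p)"

definition taylor_coeff :: "(complex \<Rightarrow> complex) \<Rightarrow> nat \<Rightarrow> complex" where
  "taylor_coeff f k = fps_nth (fps_expansion f 0) k"

text \<open>
  Series over \<open>k \<ge> n + p\<close> are written with the index shifted to start at \<open>0\<close>. Functions are
  total on the complex plane; only their values on the unit disc matter.
\<close>

definition class_A :: "nat \<Rightarrow> nat \<Rightarrow> (complex \<Rightarrow> complex) set" where
  "class_A n p =
     {f. f holomorphic_on unit_disc \<and>
         (\<forall>z \<in> unit_disc.
            (\<lambda>j. taylor_coeff f (j + (n + p)) * z ^ (j + (n + p))) sums (f z - z ^ p)) \<and>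
         p_valent p f}"

definition Phi :: "nat \<Rightarrow> nat \<Rightarrow> real \<Rightarrow> real \<Rightarrow> real \<Rightarrow> real \<Rightarrow> real" where
  "Phi p k \<delta> lam \<mu> l =
     (((real k - real p) * (lam * \<mu> * real k + lam - \<mu>) + real p + l) / (real p + l)) powr \<delta>"

definition J_op ::
  "nat \<Rightarrow> nat \<Rightarrow> real \<Rightarrow> real \<Rightarrow> real \<Rightarrow> real \<Rightarrow> (complex \<Rightarrow> complex) \<Rightarrow> complex \<Rightarrow> complex" where
  "J_op n p \<delta> lam \<mu> l f z =
     z ^ p + (\<Sum>j. complex_of_real (Phi p (j + (n + p)) \<delta> lam \<mu> l)
                    * taylor_coeff f (j + (n + p)) * z ^ (j + (n + p)))"

definition subordinate :: "(complex \<Rightarrow> complex) \<Rightarrow> (complex \<Rightarrow> complex) \<Rightarrow> bool" where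
  "subordinate F G \<longleftrightarrow>
     F holomorphic_on unit_disc \<and> G holomorphic_on unit_disc \<and>
     (\<exists>w. w holomorphic_on unit_disc \<and> w 0 = 0 \<and>
          (\<forall>z \<in> unit_disc. norm (w z) < 1 \<and> F z = G (w z)))"

text \<open>
  \<^const>\<open>remove_sings\<close> supplies the analytic extension of the quotient to \<open>z = 0\<close>.
\<close>

definition class_P ::
  "nat \<Rightarrow> real \<Rightarrow> real \<Rightarrow> real \<Rightarrow> real \<Rightarrow> real \<Rightarrow> real \<Rightarrow> real \<Rightarrow> nat \<Rightarrow> (complex \<Rightarrow> complex) set" where
  "class_P n lam \<mu> l \<delta> A B \<sigma> p =
     {f \<in> class_A n p.
        subordinate
          (\<lambda>z. 1 / complex_of_real (real p - \<sigma>) *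
               (remove_sings (\<lambda>u. deriv (J_op n p \<delta> lam \<mu> l f) u / u ^ (p - 1)) z
                 - complex_of_real \<sigma>))
          (\<lambda>z. (1 + complex_of_real A * z) / (1 + complex_of_real B * z))}"

end

theory Submission
  imports Defs "HOL-Real_Asymp.Real_Asymp"
begin

text \<open>
  Write \<open>\<theta> = z d/dz\<close> and \<open>F\<^sub>\<delta>(z) = (J\<^sup>\<delta> f)'(z) / z\<^sup>p\<^sup>-\<^sup>1\<close>. With \<open>m = k - p\<close> the bracket in
  \<open>\<Phi>\<close> is the polynomial \<open>1 + b m + a m\<^sup>2\<close>, where \<open>a = \<lambda>\<mu> / (p + l)\<close> and
  \<open>b = (\<lambda>\<mu>p + \<lambda> - \<mu>) / (p + l)\<close> are nonnegative. Since \<open>\<theta>\<close> multiplies the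
  coefficient of \<open>z\<^sup>m\<close> by \<open>m\<close>, raising \<open>\<delta>\<close> by one is a second-order differential operator:
  \<open>F\<^sub>\<delta>\<^sub>+\<^sub>1 = F\<^sub>\<delta> + b \<theta>F\<^sub>\<delta> + a \<theta>\<^sup>2F\<^sub>\<delta>\<close>. The same identity holds after the
  normalization \<open>q \<mapsto> (q - \<sigma>) / (p - \<sigma>)\<close>, because \<open>\<theta>\<close> kills constants
  (\<open>normalized_fps_add_1\<close>).

  The analytic core is \<open>convex_range_of_second_order_euler\<close>: if \<open>r + b \<theta>r + a \<theta>\<^sup>2r\<close> maps a
  disc into an open convex set \<open>K\<close>, then so does \<open>r\<close>. By separating hyperplanes only half-planes
  matter. Let \<open>Re (c r)\<close> attain its maximum over a closed disc around \<open>0\<close> at a point \<open>w\<close>. Moving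
  along the ray from \<open>0\<close> to \<open>w\<close> shows \<open>Re (c \<theta>r(w)) \<ge> 0\<close>. Moving along the circle through \<open>w\<close>, where
  differentiation in the angle is \<open>\<i>\<theta>\<close>, shows \<open>Re (c \<theta>\<^sup>2r(w)) \<ge> 0\<close>. Hence the maximum of
  \<open>Re (c r)\<close> is at most the value of \<open>Re (c (r + b \<theta>r + a \<theta>\<^sup>2r))\<close> at \<open>w\<close>.

  Finally, \<open>z \<mapsto> (1 + Az) / (1 + Bz)\<close> is injective on the disc and its image is a disc or a
  half-plane, hence open and convex. Subordination to it therefore means the value \<open>1\<close> at the
  origin together with range in this image (\<open>subordinate_moebius_iff\<close>), and the convexity result
  transfers it from \<open>F\<^sub>\<delta>\<^sub>+\<^sub>1\<close> to \<open>F\<^sub>\<delta>\<close>.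
\<close>


section \<open>The Euler operator and convex sets\<close>

definition euler :: "(complex \<Rightarrow> complex) \<Rightarrow> complex \<Rightarrow> complex" where
  "euler r z = z * deriv r z"

lemma holomorphic_on_euler [holomorphic_intros]:
  "r holomorphic_on S \<Longrightarrow> open S \<Longrightarrow> euler r holomorphic_on S"
  unfolding euler_def by (intro holomorphic_intros)

lemma second_derivative_at_max_nonpos:
  fixes f f' :: "real \<Rightarrow> real"
  assumes f: "\<And>t. (f has_real_derivative f' t) (at t)"
    and f': "(f' has_real_derivative D) (at x)"
    and max: "\<And>t. f t \<le> f x"
  shows "D \<le> 0"
proof (rule ccontr)
  assume "\<not> D \<le> 0"
  moreover have "f' x = 0"
    using DERIV_local_max[OF f[of x], of 1] max by simp
  ultimately obtain d where d: "d > 0" "\<And>h. 0 < h \<Longrightarrow> h < d \<Longrightarrow> 0 < f' (x + h)"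
    using DERIV_pos_inc_right[OF f'] by auto
  have "f x < f (x + d)"
  proof (rule DERIV_pos_imp_increasing_open[of x "x + d" f])
    fix t assume "x < t" "t < x + d"
    with d(2)[of "t - x"] f[of t] show "\<exists>y. (f has_real_derivative y) (at t) \<and> y > 0"
      by auto
  next
    show "continuous_on {x..x + d} f"
      by (rule DERIV_continuous_on[OF has_field_derivative_at_within[OF f]])
  qed (use d in auto)
  with max[of "x + d"] show False by simp
qed

text \<open>
  Reduces real derivatives along rays and circles to complex derivatives of functions of a complex
  parameter, restricted to real values of that parameter.
\<close>

lemma has_real_derivative_Re_of_real:
  assumes "(g has_field_derivative D) (at (of_real x))"
  shows "((\<lambda>t. Re (g (of_real t))) has_real_derivative Re D) (at x)"
proof -
  have "((\<lambda>t. g (of_real t)) has_vector_derivative D) (at x)"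
    using assms by (rule has_vector_derivative_real_field)
  then have "((\<lambda>t. Re (g (of_real t))) has_vector_derivative Re D) (at x)"
    by (rule bounded_linear.has_vector_derivative[OF bounded_linear_Re])
  then show ?thesis
    by (simp add: has_real_derivative_iff_has_vector_derivative)
qed

text \<open>
  In polar coordinates \<open>\<partial>/\<partial>t\<close> acts on holomorphic functions as \<open>\<i>\<theta>\<close>. Stating this for every
  holomorphic \<open>r\<close> allows it to be applied a second time, to \<open>\<theta>r\<close>.
\<close>

lemma angular_derivative:
  assumes r: "r holomorphic_on ball 0 R" and z: "z \<in> ball 0 R"
  shows "((\<lambda>t. Re (c * r (z * exp (\<i> * of_real t)))) has_real_derivative
            Re (\<i> * c * euler r (z * exp (\<i> * of_real x)))) (at x)"
proof -
  define e where "e = z * exp (\<i> * of_real x)"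
  have "e \<in> ball 0 R" using z by (simp add: e_def norm_mult)
  then have "(r has_field_derivative deriv r e) (at e)"
    using r by (intro holomorphic_derivI[of _ "ball 0 R"]) auto
  then have "((\<lambda>\<zeta>. c * r (z * exp (\<i> * \<zeta>))) has_field_derivative \<i> * c * euler r e)
               (at (of_real x))"
    unfolding e_def euler_def by (auto intro!: derivative_eq_intros DERIV_chain2[of r])
  then show ?thesis
    unfolding e_def by (rule has_real_derivative_Re_of_real)
qed

text \<open>
  The first inequality is the sign of the radial derivative, seen from inside the disc. The second
  is the second-derivative test on the circle through \<open>z\<close>; the sign is positive because
  \<open>\<i>\<theta>\<close> applied twice is \<open>-\<theta>\<^sup>2\<close>. A maximum at the centre is not special: both quantities
  vanish there.
\<close>

lemma euler_at_max_on_disc: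
  assumes r: "r holomorphic_on ball 0 R" and z: "z \<in> ball 0 R"
    and max: "\<And>y. norm y \<le> norm z \<Longrightarrow> Re (c * r y) \<le> Re (c * r z)"
  shows "Re (c * euler r z) \<ge> 0" and "Re (c * euler (euler r) z) \<ge> 0"
proof -
  show "Re (c * euler r z) \<ge> 0"
  proof (rule ccontr)
    assume neg: "\<not> ?thesis"
    have "(r has_field_derivative deriv r z) (at z)"
      using r z by (intro holomorphic_derivI[of _ "ball 0 R"]) auto
    then have "((\<lambda>\<zeta>. c * r (z * \<zeta>)) has_field_derivative c * euler r z) (at (of_real 1))"
      unfolding euler_def by (auto intro!: derivative_eq_intros DERIV_chain2[of r])
    then have "((\<lambda>t. Re (c * r (z * of_real t))) has_real_derivative Re (c * euler r z)) (at 1)"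
      by (rule has_real_derivative_Re_of_real)
    then have "\<exists>d>0. \<forall>h>0. h < d \<longrightarrow>
        Re (c * r (z * of_real 1)) < Re (c * r (z * of_real (1 - h)))"
      by (rule DERIV_neg_dec_left) (use neg in simp)
    then obtain d where d: "d > 0"
      "\<And>h. 0 < h \<Longrightarrow> h < d \<Longrightarrow> Re (c * r (z * of_real 1)) < Re (c * r (z * of_real (1 - h)))"
      by blast
    \<comment> \<open>The cap at \<open>1\<close> keeps \<open>z * (1 - h)\<close> inside the closed disc.\<close>
    define h where "h = min (d / 2) 1"
    have h: "0 < h" "h < d" "h \<le> 1" using d(1) by (auto simp: h_def)
    have "norm (z * of_real (1 - h)) = norm z * (1 - h)"
      using h by (simp add: norm_mult del: of_real_diff)
    also have "\<dots> \<le> norm z" using h by (simp add: mult_left_le)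
    finally have "norm (z * of_real (1 - h)) \<le> norm z" .
    from max[OF this] d(2)[OF h(1,2)] show False by simp
  qed
  have "((\<lambda>t. Re (\<i> * c * euler r (z * exp (\<i> * of_real t)))) has_real_derivative
          Re (\<i> * (\<i> * c) * euler (euler r) (z * exp (\<i> * of_real 0)))) (at 0)"
    by (rule angular_derivative) (use r z in \<open>auto intro: holomorphic_intros\<close>)
  then have "Re (\<i> * (\<i> * c) * euler (euler r) (z * exp (\<i> * of_real 0))) \<le> 0"
    by (rule second_derivative_at_max_nonpos[OF angular_derivative[OF r z]])
       (use max in \<open>simp add: norm_mult del: times_complex.sel\<close>)
  then show "Re (c * euler (euler r) z) \<ge> 0"
    by (simp add: algebra_simps)
qed

text \<open>
  An open convex set is an intersection of open half-planes, so a value \<open>r z\<close> outside \<open>K\<close> is cut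
  off from \<open>K\<close> by a linear functional \<open>y \<mapsto> v \<bullet> y = Re (cnj v * y)\<close>. The maximum of this
  functional along \<open>r\<close> on the closed disc through \<open>z\<close> is dominated by its value at a point \<open>G\<close> of
  \<open>K\<close>; as \<open>K\<close> is open, it still grows beyond \<open>G\<close> inside \<open>K\<close>.
\<close>

theorem convex_range_of_second_order_euler:
  assumes r: "r holomorphic_on ball 0 R" and ab: "a \<ge> 0" "b \<ge> 0"
    and K: "convex K" "open K"
    and g: "\<And>z. z \<in> ball 0 R \<Longrightarrow>
              r z + of_real b * euler r z + of_real a * euler (euler r) z \<in> K"
    and z: "z \<in> ball 0 R"
  shows "r z \<in> K"
proof (rule ccontr)
  assume "r z \<notin> K"
  moreover have "K \<noteq> {}" using g z by blast
  ultimately obtain v s where v: "v \<noteq> 0" "\<And>x. x \<in> K \<Longrightarrow> inner v x \<le> s" "s \<le> inner v (r z)"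
    using separating_hyperplane_sets[of K "{r z}"] K by auto
  have inner_Re: "inner v x = Re (cnj v * x)" for x
    by (simp add: inner_complex_def)
  have "continuous_on (cball 0 (norm z)) (\<lambda>y. Re (cnj v * r y))"
    using z by (intro continuous_intros holomorphic_on_imp_continuous_on
                      holomorphic_on_subset[OF r]) auto
  then obtain w where w: "norm w \<le> norm z"
    "\<And>y. norm y \<le> norm z \<Longrightarrow> Re (cnj v * r y) \<le> Re (cnj v * r w)"
    using continuous_attains_sup[of "cball 0 (norm z)" "\<lambda>y. Re (cnj v * r y)"] by force
  have wR: "w \<in> ball 0 R" using w z by simp
  define G where "G = r w + of_real b * euler r w + of_real a * euler (euler r) w"
  have G: "G \<in> K" using g[OF wR] by (simp add: G_def)
  have "Re (cnj v * G) = Re (cnj v * r w) + b * Re (cnj v * euler r w)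
          + a * Re (cnj v * euler (euler r) w)"
    by (simp add: G_def algebra_simps)
  moreover have "Re (cnj v * euler r w) \<ge> 0" "Re (cnj v * euler (euler r) w) \<ge> 0"
    by (rule euler_at_max_on_disc[OF r wR]; use w order_trans in blast)+
  ultimately have "Re (cnj v * r w) \<le> Re (cnj v * G)"
    using ab by simp
  with w(2)[of z] v(3) have "s \<le> inner v G" by (simp add: inner_Re)
  moreover from K(2) G obtain e where e: "e > 0" "ball G e \<subseteq> K"
    by (meson openE)
  \<comment> \<open>A step of length \<open>e / 2\<close> from \<open>G\<close> in the direction \<open>v\<close> stays in \<open>K\<close>.\<close>
  have "G + of_real (e / (2 * norm v)) * v \<in> ball G e"
    using e v(1) by (simp add: dist_norm norm_mult norm_divide)
  with e v(2) have "inner v (G + (e / (2 * norm v)) *\<^sub>R v) \<le> s"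
    by (auto simp: scaleR_conv_of_real)
  moreover have "inner v ((e / (2 * norm v)) *\<^sub>R v) > 0"
    using e v(1) by simp
  ultimately show False by (simp add: inner_add_right)
qed


section \<open>Subordination to a Moebius map\<close>

text \<open>
  Solving \<open>q = (1 + Aw) / (1 + Bw)\<close> gives \<open>w = (1 - q) / (Bq - A)\<close>, so for \<open>A < B\<close> and
  \<open>\<bar>B\<bar> \<le> 1\<close> this set, which expresses \<open>norm w < 1\<close>, is the image of the unit disc.
\<close>

definition moebius_image :: "real \<Rightarrow> real \<Rightarrow> complex set" where
  "moebius_image A B = {q. norm (1 - q) < norm (of_real B * q - of_real A)}"

lemma open_moebius_image: "open (moebius_image A B)"
  unfolding moebius_image_def by (intro open_Collect_less continuous_intros)

text \<open>
  The difference \<open>\<phi>\<close> of the squared norms is a real quadratic whose leading part is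
  \<open>(1 - B\<^sup>2) (norm q)\<^sup>2\<close>. It is therefore convex, and its sublevel set is convex; this treats discs
  (\<open>\<bar>B\<bar> < 1\<close>) and half-planes (\<open>\<bar>B\<bar> = 1\<close>) together.
\<close>

lemma convex_moebius_image:
  assumes "\<bar>B\<bar> \<le> 1"
  shows "convex (moebius_image A B)"
proof -
  define \<phi> where "\<phi> q = (norm (1 - q))\<^sup>2 - (norm (of_real B * q - of_real A))\<^sup>2" for q :: complex
  have iff: "q \<in> moebius_image A B \<longleftrightarrow> \<phi> q < 0" for q
    unfolding moebius_image_def \<phi>_def
    by (auto intro: power2_less_imp_less power_strict_mono)
  have \<phi>: "\<phi> (u *\<^sub>R x + v *\<^sub>R y) = u * \<phi> x + v * \<phi> y - (1 - B\<^sup>2) * (u * v) * (norm (x - y))\<^sup>2"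
    if "u + v = 1" for x y u v
  proof -
    have v: "v = 1 - u" using that by simp
    show ?thesis
      unfolding \<phi>_def cmod_power2 v by (simp add: power2_eq_square algebra_simps)
  qed
  have "1 - B\<^sup>2 \<ge> 0" using assms by (simp add: abs_square_le_1)
  show ?thesis
  proof (rule convexI)
    fix x y and u v :: real
    assume xy: "x \<in> moebius_image A B" "y \<in> moebius_image A B" and uv: "0 \<le> u" "0 \<le> v" "u + v = 1"
    have "u * \<phi> x + v * \<phi> y < 0"
      using xy uv convex_bound_lt[of "\<phi> x" 0 "\<phi> y" u v] by (simp add: iff)
    moreover have "(1 - B\<^sup>2) * (u * v) * (norm (x - y))\<^sup>2 \<ge> 0"
      using uv \<open>1 - B\<^sup>2 \<ge> 0\<close> by simp
    ultimately show "u *\<^sub>R x + v *\<^sub>R y \<in> moebius_image A B"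
      by (simp add: iff \<phi>[OF uv(3)])
  qed
qed

lemma moebius_denominator_nonzero:
  assumes "\<bar>B\<bar> \<le> 1" "norm (w::complex) < 1"
  shows "1 + of_real B * w \<noteq> 0"
proof
  assume "1 + of_real B * w = 0"
  then have "of_real B * w = -1" by (simp add: add_eq_0_iff)
  then have "\<bar>B\<bar> * norm w = 1"
    by (metis norm_mult norm_of_real norm_minus_cancel norm_one)
  with assms mult_mono[of "\<bar>B\<bar>" 1 "norm w" "norm w"] show False by simp
qed

lemma moebius_in_image:
  assumes "A < B" "\<bar>B\<bar> \<le> 1" "norm w < 1"
  shows "(1 + of_real A * w) / (1 + of_real B * w) \<in> moebius_image A B"
proof -
  define q where "q = (1 + of_real A * w) / (1 + of_real B * w)"
  note nz = moebius_denominator_nonzero[OF assms(2,3)]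
  have "1 - q = of_real (B - A) * w / (1 + of_real B * w)"
       "of_real B * q - of_real A = of_real (B - A) / (1 + of_real B * w)"
    unfolding q_def using nz by (simp_all add: field_simps)
  then have "norm (1 - q) = norm (of_real B * q - of_real A) * norm w"
      "norm (of_real B * q - of_real A) > 0"
    using nz assms(1) by (simp_all add: norm_mult norm_divide del: of_real_diff)
  with assms(3) show ?thesis
    unfolding moebius_image_def q_def[symmetric] by simp
qed

text \<open>
  The Schwarz function is obtained by inverting the Moebius map. It fixes \<open>0\<close> because \<open>F 0 = 1\<close>.
\<close>

lemma subordinate_moebius_iff:
  assumes AB: "A < B" "\<bar>B\<bar> \<le> 1" and F: "F holomorphic_on unit_disc" and F0: "F 0 = 1"
  shows "subordinate F (\<lambda>z. (1 + of_real A * z) / (1 + of_real B * z)) \<longleftrightarrow>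
           (\<forall>z\<in>unit_disc. F z \<in> moebius_image A B)" (is "?L \<longleftrightarrow> ?R")
proof
  assume ?L
  then show ?R
    unfolding subordinate_def using moebius_in_image[OF AB] by auto
next
  assume R: ?R
  define w where "w z = (1 - F z) / (of_real B * F z - of_real A)" for z
  have less: "norm (1 - F z) < norm (of_real B * F z - of_real A)" if "z \<in> unit_disc" for z
    using R that by (auto simp: moebius_image_def)
  have nz: "of_real B * F z - of_real A \<noteq> 0" if "z \<in> unit_disc" for z
    using less[OF that] norm_ge_zero[of "1 - F z"] by (metis norm_zero not_less)
  have "w holomorphic_on unit_disc"
    unfolding w_def using F nz by (intro holomorphic_intros) auto
  moreover have "w 0 = 0" by (simp add: w_def F0)
  moreover have w1: "norm (w z) < 1" if "z \<in> unit_disc" for z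
    using less[OF that] nz[OF that] by (simp add: w_def norm_divide)
  moreover have "F z = (1 + of_real A * w z) / (1 + of_real B * w z)" if z: "z \<in> unit_disc" for z
  proof -
    define D where "D = of_real B * F z - of_real A"
    have D: "D \<noteq> 0" using nz[OF z] by (simp add: D_def)
    have "1 + of_real A * w z = of_real (B - A) * F z / D"
         "1 + of_real B * w z = of_real (B - A) / D"
      using D unfolding w_def D_def[symmetric] by (simp_all add: field_simps) (simp_all add: D_def algebra_simps)
    then show ?thesis using AB(1) D by simp
  qed
  moreover have "(\<lambda>z. (1 + of_real A * z) / (1 + of_real B * z)) holomorphic_on unit_disc"
    by (intro holomorphic_intros) (use moebius_denominator_nonzero[OF AB(2)] in auto)
  ultimately show ?L
    unfolding subordinate_def using F by blast
qed

section \<open>Coefficient multipliers of power series\<close>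

text \<open>
  A factor of polynomial growth is absorbed by passing from \<open>r\<close> to a slightly larger radius \<open>s\<close>,
  because polynomial growth times \<open>(r / s)\<^sup>k\<close> tends to \<open>0\<close>.
\<close>

lemma fps_conv_radius_polynomial_multiplier:
  fixes F G :: "complex fps"
  assumes C: "C > 0"
    and G: "\<And>k. norm (fps_nth G k) \<le> (C * (real k + 1)\<^sup>2) powr d * norm (fps_nth F k)"
  shows "fps_conv_radius F \<le> fps_conv_radius G"
  unfolding fps_conv_radius_def
proof (rule conv_radius_geI_ex)
  fix r :: real assume r: "0 < r" "ereal r < conv_radius (fps_nth F)"
  then obtain s where s: "r < s" "ereal s < conv_radius (fps_nth F)"
    using ereal_dense2 by force
  have "summable (\<lambda>k. norm (fps_nth F k * of_real s ^ k))"
    using r s by (intro abs_summable_in_conv_radius) auto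
  moreover have "(\<lambda>k. (C * (real k + 1)\<^sup>2) powr d * (r / s) ^ k) \<longlonglongrightarrow> 0"
  proof -
    have "(\<lambda>k. (C * (real k + 1)\<^sup>2) powr d * x ^ k) \<longlonglongrightarrow> 0"
      if "0 < x" "x < 1" for x :: real
      using that C by real_asymp
    then show ?thesis using r s by simp
  qed
  then have "\<forall>\<^sub>F k in sequentially. (C * (real k + 1)\<^sup>2) powr d * (r / s) ^ k < 1"
    by (rule order_tendstoD) simp
  then have "\<forall>\<^sub>F k in sequentially.
      norm (fps_nth G k * of_real r ^ k) \<le> norm (fps_nth F k * of_real s ^ k)"
  proof eventually_elim
    case (elim k)
    have "norm (fps_nth G k * of_real r ^ k)
            \<le> (C * (real k + 1)\<^sup>2) powr d * norm (fps_nth F k) * r ^ k"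
      using G[of k] r by (simp add: norm_mult norm_power mult_right_mono)
    also have "\<dots> = ((C * (real k + 1)\<^sup>2) powr d * (r / s) ^ k) * (norm (fps_nth F k) * s ^ k)"
      using r s by (simp add: power_divide)
    also have "\<dots> \<le> 1 * (norm (fps_nth F k) * s ^ k)"
      using elim r s by (intro mult_right_mono) auto
    finally show ?case using r s by (simp add: norm_mult norm_power)
  qed
  ultimately have "summable (\<lambda>k. fps_nth G k * of_real r ^ k)"
    by (rule summable_comparison_test_ev[rotated])
  then show "\<exists>z. norm z = r \<and> summable (\<lambda>k. fps_nth G k * z ^ k)"
    using r by (intro exI[of _ "of_real r"]) auto
qed

lemma eval_fps_XD:
  fixes F :: "complex fps"
  assumes F: "fps_conv_radius F \<ge> ereal R" and z: "z \<in> ball 0 R"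
  shows "eval_fps (fps_XD F) z = euler (eval_fps F) z"
proof -
  have z': "ereal (norm z) < fps_conv_radius F"
    using z by (intro less_le_trans[OF _ F]) simp
  then have "ereal (norm z) < fps_conv_radius (fps_deriv F)"
    using fps_conv_radius_deriv[of F] by simp
  moreover have "deriv (eval_fps F) z = eval_fps (fps_deriv F) z"
    using z' by (intro DERIV_imp_deriv has_field_derivative_eval_fps)
  ultimately show ?thesis
    by (simp add: fps_XD_def euler_def eval_fps_mult)
qed

lemma fps_conv_radius_XD: "fps_conv_radius (fps_XD F) \<ge> fps_conv_radius (F :: complex fps)"
  using fps_conv_radius_mult[of fps_X "fps_deriv F"] fps_conv_radius_deriv[of F]
  by (simp add: fps_XD_def)

lemma eval_fps_XD_XD:
  fixes F :: "complex fps"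
  assumes F: "fps_conv_radius F \<ge> ereal R" and z: "z \<in> ball 0 R"
  shows "eval_fps (fps_XD (fps_XD F)) z = euler (euler (eval_fps F)) z"
proof -
  have "eval_fps (fps_XD (fps_XD F)) z = euler (eval_fps (fps_XD F)) z"
    using assms fps_conv_radius_XD[of F] by (intro eval_fps_XD[of R]) auto
  also have "deriv (eval_fps (fps_XD F)) z = deriv (euler (eval_fps F)) z"
    using eventually_nhds_in_open[of "ball 0 R" z] z
    by (intro deriv_cong_ev refl) (auto elim!: eventually_mono intro!: eval_fps_XD[OF F])
  then have "euler (eval_fps (fps_XD F)) z = euler (euler (eval_fps F)) z"
    by (simp add: euler_def)
  finally show ?thesis .
qed

lemma fps_conv_radius_affine:
  "fps_conv_radius (fps_const c * (E - fps_const d)) \<ge> fps_conv_radius (E :: complex fps)"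
proof -
  have "fps_conv_radius E \<le> fps_conv_radius (E - fps_const d)"
    using fps_conv_radius_diff[of E "fps_const d"] by simp
  also have "\<dots> \<le> fps_conv_radius (fps_const c * (E - fps_const d))"
    using fps_conv_radius_mult[of "fps_const c" "E - fps_const d"] by simp
  finally show ?thesis .
qed


section \<open>The differential relation between consecutive parameters\<close>

locale J_operator =
  fixes n p :: nat and lam \<mu> l :: real and f :: "complex \<Rightarrow> complex"
  assumes n: "n \<ge> 1" and p: "p \<ge> 1" and lam: "lam \<ge> \<mu>" and \<mu>: "\<mu> \<ge> 0" and l: "l \<ge> 0"
    and f: "f holomorphic_on unit_disc"
begin

definition J_fps :: "real \<Rightarrow> complex fps" where
  "J_fps \<delta> = fps_X ^ p +
     Abs_fps (\<lambda>k. if k < n + p then 0 else of_real (Phi p k \<delta> lam \<mu> l) * taylor_coeff f k)"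

text \<open>The expansion of \<open>(J\<^sup>\<delta> f)'(z) / z\<^sup>p\<^sup>-\<^sup>1\<close>, which is \<open>p\<close> at \<open>z = 0\<close>.\<close>

definition quotient_fps :: "real \<Rightarrow> complex fps" where
  "quotient_fps \<delta> = fps_shift (p - 1) (fps_deriv (J_fps \<delta>))"

definition a :: real where "a = lam * \<mu> / (real p + l)"

definition b :: real where "b = (lam * \<mu> * real p + lam - \<mu>) / (real p + l)"

lemma a_nonneg: "a \<ge> 0" and b_nonneg: "b \<ge> 0"
proof -
  show "a \<ge> 0" using lam \<mu> l by (simp add: a_def)
  have "lam * \<mu> * real p + (lam - \<mu>) \<ge> 0" using lam \<mu> by (intro add_nonneg_nonneg) auto
  then show "b \<ge> 0" using l by (simp add: b_def)
qed

lemma Phi_eq: "Phi p (m + p) \<delta> lam \<mu> l = (1 + b * real m + a * (real m)\<^sup>2) powr \<delta>"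
proof -
  define c where "c = real p + l"
  have c: "c > 0" using p l by (simp add: c_def)
  have "real (m + p) - real p = real m" by simp
  then have "((real (m + p) - real p) * (lam * \<mu> * real (m + p) + lam - \<mu>) + real p + l) / (real p + l)
      = 1 + b * real m + a * (real m)\<^sup>2"
    unfolding a_def b_def add.assoc c_def[symmetric] using c
    by (simp add: field_simps power2_eq_square)
  then show ?thesis by (simp add: Phi_def)
qed

lemma Phi_add_1:
  "Phi p (m + p) (\<delta> + 1) lam \<mu> l =
     Phi p (m + p) \<delta> lam \<mu> l * (1 + b * real m + a * (real m)\<^sup>2)"
proof -
  have "1 + b * real m + a * (real m)\<^sup>2 > 0"
    using a_nonneg b_nonneg by (intro add_pos_nonneg) auto
  then show ?thesis by (simp add: Phi_eq powr_add)
qed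

text \<open>
  The series in the definition of \<^const>\<open>J_op\<close> really converges on the disc: the Taylor series of
  \<open>f\<close> does, and \<open>\<Phi>\<close> grows at most like a power of \<open>k\<close>.
\<close>

lemma J_series_conv_radius:
  assumes "\<delta> \<ge> 0"
  shows "fps_conv_radius (Abs_fps (\<lambda>k. if k < n + p then 0
           else of_real (Phi p k \<delta> lam \<mu> l) * taylor_coeff f k)) \<ge> 1" (is "fps_conv_radius ?S \<ge> 1")
proof -
  have "fps_conv_radius (fps_expansion f 0) \<le> fps_conv_radius ?S"
  proof (rule fps_conv_radius_polynomial_multiplier)
    show "1 + b + a > 0" using a_nonneg b_nonneg by simp
  next
    fix k
    show "norm (fps_nth ?S k)
            \<le> ((1 + b + a) * (real k + 1)\<^sup>2) powr \<delta> * norm (fps_nth (fps_expansion f 0) k)"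
    proof (cases "k < n + p")
      case False
      define m where "m = k - p"
      have m: "k = m + p" using False by (simp add: m_def)
      have ineq: "1 \<le> (real k + 1)\<^sup>2" "real m \<le> (real k + 1)\<^sup>2" "(real m)\<^sup>2 \<le> (real k + 1)\<^sup>2"
        unfolding m by (auto simp: power2_eq_square algebra_simps)
      have "1 + b * real m + a * (real m)\<^sup>2
              \<le> (real k + 1)\<^sup>2 + b * (real k + 1)\<^sup>2 + a * (real k + 1)\<^sup>2"
        using ineq a_nonneg b_nonneg by (intro add_mono mult_left_mono) auto
      also have "\<dots> = (1 + b + a) * (real k + 1)\<^sup>2" by (simp add: algebra_simps)
      finally have "Phi p k \<delta> lam \<mu> l \<le> ((1 + b + a) * (real k + 1)\<^sup>2) powr \<delta>"
        unfolding m Phi_eq using assms a_nonneg b_nonneg by (intro powr_mono2) auto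
      moreover have "Phi p k \<delta> lam \<mu> l \<ge> 0" by (simp add: Phi_def)
      ultimately show ?thesis using False
        by (simp add: norm_mult taylor_coeff_def mult_right_mono)
    qed auto
  qed
  moreover have "fps_conv_radius (fps_expansion f 0) \<ge> 1"
    using f by (intro conv_radius_fps_expansion) (simp add: one_ereal_def eball_def ball_def)
  ultimately show ?thesis by (rule order_trans[rotated])
qed

lemma J_fps_conv_radius: "\<delta> \<ge> 0 \<Longrightarrow> fps_conv_radius (J_fps \<delta>) \<ge> 1"
  unfolding J_fps_def by (rule order_trans[OF _ fps_conv_radius_add]) (simp add: J_series_conv_radius)

lemma in_disc_conv:
  "z \<in> unit_disc \<Longrightarrow> fps_conv_radius F \<ge> 1 \<Longrightarrow> ereal (norm z) < fps_conv_radius F"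
  by (rule less_le_trans[of _ 1]) simp_all

lemma J_op_eq_eval_fps:
  assumes \<delta>: "\<delta> \<ge> 0" and z: "z \<in> unit_disc"
  shows "J_op n p \<delta> lam \<mu> l f z = eval_fps (J_fps \<delta>) z"
proof -
  let ?S = "Abs_fps (\<lambda>k. if k < n + p then 0 else of_real (Phi p k \<delta> lam \<mu> l) * taylor_coeff f k)"
  note conv = in_disc_conv[OF z J_series_conv_radius[OF \<delta>]]
  have "(\<lambda>k. fps_nth ?S k * z ^ k) sums eval_fps ?S z"
    by (rule sums_eval_fps[OF conv])
  then have "(\<lambda>j. fps_nth ?S (j + (n + p)) * z ^ (j + (n + p))) sums eval_fps ?S z"
    by (subst sums_zero_iff_shift) auto
  then have "(\<Sum>j. of_real (Phi p (j + (n + p)) \<delta> lam \<mu> l) * taylor_coeff f (j + (n + p))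
                * z ^ (j + (n + p))) = eval_fps ?S z"
    by (simp add: sums_iff)
  then show ?thesis
    using conv by (simp add: J_op_def J_fps_def eval_fps_add)
qed

lemma quotient_fps_nth:
  "fps_nth (quotient_fps \<delta>) m = of_nat (m + p) *
     (if m = 0 then 1 else if m < n then 0
      else of_real (Phi p (m + p) \<delta> lam \<mu> l) * taylor_coeff f (m + p))"
proof -
  have "Suc (m + (p - 1)) = m + p" using p by simp
  then show ?thesis
    using n p by (auto simp: quotient_fps_def J_fps_def fps_X_power_iff algebra_simps)
qed

lemma quotient_fps_conv_radius: "\<delta> \<ge> 0 \<Longrightarrow> fps_conv_radius (quotient_fps \<delta>) \<ge> 1"
  unfolding quotient_fps_def
  using J_fps_conv_radius[of \<delta>] fps_conv_radius_deriv[of "J_fps \<delta>"] by simp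

text \<open>
  At every point of the disc, including \<open>0\<close>, the quotient agrees with the power series on a
  punctured neighbourhood, so its limit there is the value of the series.
\<close>

lemma remove_sings_quotient:
  assumes \<delta>: "\<delta> \<ge> 0" and z: "z \<in> unit_disc"
  shows "remove_sings (\<lambda>u. deriv (J_op n p \<delta> lam \<mu> l f) u / u ^ (p - 1)) z
           = eval_fps (quotient_fps \<delta>) z"
proof -
  let ?J = "J_op n p \<delta> lam \<mu> l f" and ?E = "eval_fps (quotient_fps \<delta>)"
  have quot: "deriv ?J u / u ^ (p - 1) = ?E u" if u: "u \<in> unit_disc" "u \<noteq> 0" for u
  proof -
    note conv = in_disc_conv[OF u(1) J_fps_conv_radius[OF \<delta>]]
    have "deriv ?J u = deriv (eval_fps (J_fps \<delta>)) u"
      using eventually_nhds_in_open[of unit_disc u] u(1)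
      by (intro deriv_cong_ev refl) (auto elim!: eventually_mono intro!: J_op_eq_eval_fps \<delta>)
    also have "\<dots> = eval_fps (fps_deriv (J_fps \<delta>)) u"
      using conv by (intro DERIV_imp_deriv has_field_derivative_eval_fps)
    finally have "deriv ?J u = \<dots>" .
    moreover have "subdegree (fps_deriv (J_fps \<delta>)) = p - 1"
      using n p by (intro subdegreeI) (auto simp: J_fps_def fps_X_power_iff)
    moreover have "ereal (norm u) < fps_conv_radius (fps_deriv (J_fps \<delta>))"
      using conv fps_conv_radius_deriv[of "J_fps \<delta>"] by simp
    ultimately show ?thesis
      using u(2) by (simp add: quotient_fps_def eval_fps_shift)
  qed
  have "\<forall>\<^sub>F u in at z. u \<in> unit_disc \<and> u \<noteq> 0"
    using z by (intro eventually_conj eventually_at_in_open' eventually_neq_at_within) auto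
  then have "\<forall>\<^sub>F u in at z. ?E u = deriv ?J u / u ^ (p - 1)"
    by eventually_elim (use quot in presburger)
  moreover have "?E \<midarrow>z\<rightarrow> ?E z"
    using in_disc_conv[OF z quotient_fps_conv_radius[OF \<delta>]]
    by (intro isContD[OF DERIV_isCont[OF has_field_derivative_eval_fps]])
  ultimately show ?thesis
    by (intro remove_sings_eqI) (rule Lim_transform_eventually)
qed

text \<open>
  The expansion of the function whose subordination defines \<^const>\<open>class_P\<close>.
\<close>

definition normalized_fps :: "real \<Rightarrow> real \<Rightarrow> complex fps" where
  "normalized_fps \<sigma> \<delta> =
     fps_const (of_real (1 / (real p - \<sigma>))) * (quotient_fps \<delta> - fps_const (of_real \<sigma>))"

lemma normalized_fps_conv_radius: "\<delta> \<ge> 0 \<Longrightarrow> fps_conv_radius (normalized_fps \<sigma> \<delta>) \<ge> 1"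
  unfolding normalized_fps_def
  using quotient_fps_conv_radius fps_conv_radius_affine by (rule order_trans)

lemma eval_normalized_fps:
  assumes \<delta>: "\<delta> \<ge> 0" and z: "z \<in> unit_disc"
  shows "eval_fps (normalized_fps \<sigma> \<delta>) z =
    1 / of_real (real p - \<sigma>) *
      (remove_sings (\<lambda>u. deriv (J_op n p \<delta> lam \<mu> l f) u / u ^ (p - 1)) z - of_real \<sigma>)"
proof -
  note conv = in_disc_conv[OF z quotient_fps_conv_radius[OF \<delta>]]
  then have "ereal (norm z) < fps_conv_radius (quotient_fps \<delta> - fps_const (of_real \<sigma>))"
    using fps_conv_radius_diff[of "quotient_fps \<delta>" "fps_const (of_real \<sigma>)"] by simp
  with conv show ?thesis
    unfolding remove_sings_quotient[OF assms]
    by (simp add: normalized_fps_def eval_fps_mult eval_fps_diff)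
qed

lemma quotient_fps_nth_add_1:
  "fps_nth (quotient_fps (\<delta> + 1)) m =
     of_real (1 + b * real m + a * (real m)\<^sup>2) * fps_nth (quotient_fps \<delta>) m"
  by (cases "m = 0") (simp_all add: quotient_fps_nth Phi_add_1)

text \<open>
  Raising \<open>\<delta>\<close> by one applies \<open>1 + b \<theta> + a \<theta>\<^sup>2\<close>. The constant \<open>\<sigma>\<close> does not disturb this, as it
  only enters the coefficient of \<open>z\<^sup>0\<close>, where the operator is the identity.
\<close>

lemma normalized_fps_add_1:
  "normalized_fps \<sigma> (\<delta> + 1) = normalized_fps \<sigma> \<delta>
     + fps_const (of_real b) * fps_XD (normalized_fps \<sigma> \<delta>)
     + fps_const (of_real a) * fps_XD (fps_XD (normalized_fps \<sigma> \<delta>))"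
proof (rule fps_ext)
  fix m
  show "fps_nth (normalized_fps \<sigma> (\<delta> + 1)) m = fps_nth (normalized_fps \<sigma> \<delta>
     + fps_const (of_real b) * fps_XD (normalized_fps \<sigma> \<delta>)
     + fps_const (of_real a) * fps_XD (fps_XD (normalized_fps \<sigma> \<delta>))) m"
    by (simp add: normalized_fps_def quotient_fps_nth_add_1 power2_eq_square)
       (simp add: algebra_simps add_divide_distrib)
qed

lemma subordinate_normalized_iff:
  assumes \<delta>: "\<delta> \<ge> 0" and \<sigma>: "\<sigma> < real p" and AB: "A < B" "\<bar>B\<bar> \<le> 1"
  shows "subordinate
          (\<lambda>z. 1 / complex_of_real (real p - \<sigma>) *
               (remove_sings (\<lambda>u. deriv (J_op n p \<delta> lam \<mu> l f) u / u ^ (p - 1)) z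
                 - complex_of_real \<sigma>))
          (\<lambda>z. (1 + complex_of_real A * z) / (1 + complex_of_real B * z)) \<longleftrightarrow>
         (\<forall>z\<in>unit_disc. eval_fps (normalized_fps \<sigma> \<delta>) z \<in> moebius_image A B)"
    (is "subordinate ?F _ \<longleftrightarrow> _")
proof -
  have eq: "?F z = eval_fps (normalized_fps \<sigma> \<delta>) z" if "z \<in> unit_disc" for z
    using eval_normalized_fps[OF \<delta> that] by simp
  have "eval_fps (normalized_fps \<sigma> \<delta>) holomorphic_on unit_disc"
    using in_disc_conv[OF _ normalized_fps_conv_radius[OF \<delta>]]
    by (intro holomorphic_on_eval_fps) (auto simp: in_eball_iff)
  then have "?F holomorphic_on unit_disc"
    by (rule holomorphic_transform) (simp only: eq)
  moreover have "?F 0 = 1"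
  proof -
    have "of_real (real p) \<noteq> (of_real \<sigma> :: complex)"
      using \<sigma> unfolding of_real_eq_iff by simp
    then have "fps_nth (normalized_fps \<sigma> \<delta>) 0 = 1"
      by (simp add: normalized_fps_def quotient_fps_nth)
    then show ?thesis
      using eq[of 0] by (simp only: eval_fps_at_0 centre_in_ball zero_less_one)
  qed
  ultimately show ?thesis
    using subordinate_moebius_iff[OF AB, of ?F] eq by (metis (no_types, lifting))
qed

lemma range_in_moebius_image_decrease_parameter:
  assumes \<delta>: "\<delta> \<ge> 0" and B: "\<bar>B\<bar> \<le> 1"
    and K: "\<And>z. z \<in> unit_disc \<Longrightarrow> eval_fps (normalized_fps \<sigma> (\<delta> + 1)) z \<in> moebius_image A B"
    and z: "z \<in> unit_disc"
  shows "eval_fps (normalized_fps \<sigma> \<delta>) z \<in> moebius_image A B"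
proof (rule convex_range_of_second_order_euler[OF _ a_nonneg b_nonneg
          convex_moebius_image[OF B] open_moebius_image _ z])
  let ?Q = "normalized_fps \<sigma> \<delta>"
  note rad = normalized_fps_conv_radius[OF \<delta>, of \<sigma>]
  show "eval_fps ?Q holomorphic_on unit_disc"
    using in_disc_conv[OF _ rad] by (intro holomorphic_on_eval_fps) (auto simp: in_eball_iff)
  fix y assume y: "y \<in> unit_disc"
  have r1: "fps_conv_radius (fps_XD ?Q) \<ge> 1"
    using rad fps_conv_radius_XD by (rule order_trans)
  then have r2: "fps_conv_radius (fps_XD (fps_XD ?Q)) \<ge> 1"
    using fps_conv_radius_XD by (rule order_trans)
  have mult: "fps_conv_radius (fps_const c * F) \<ge> 1" if "fps_conv_radius F \<ge> 1" for c and F :: "complex fps"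
    using that fps_conv_radius_mult[of "fps_const c" F] by simp
  have sum: "fps_conv_radius (?Q + fps_const (of_real b) * fps_XD ?Q) \<ge> 1"
    by (rule order_trans[OF _ fps_conv_radius_add]) (simp add: rad mult[OF r1])
  have "eval_fps (normalized_fps \<sigma> (\<delta> + 1)) y = eval_fps ?Q y
     + of_real b * eval_fps (fps_XD ?Q) y + of_real a * eval_fps (fps_XD (fps_XD ?Q)) y"
    unfolding normalized_fps_add_1
    using in_disc_conv[OF y rad] in_disc_conv[OF y r1] in_disc_conv[OF y r2]
      in_disc_conv[OF y sum] in_disc_conv[OF y mult[OF r1]] in_disc_conv[OF y mult[OF r2]]
    by (simp add: eval_fps_add eval_fps_mult)
  also have "eval_fps (fps_XD ?Q) y = euler (eval_fps ?Q) y"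
    using rad y by (intro eval_fps_XD[of 1]) (simp_all add: one_ereal_def)
  also have "eval_fps (fps_XD (fps_XD ?Q)) y = euler (euler (eval_fps ?Q)) y"
    using rad y by (intro eval_fps_XD_XD[of 1]) (simp_all add: one_ereal_def)
  finally show "eval_fps ?Q y + of_real b * euler (eval_fps ?Q) y
                  + of_real a * euler (euler (eval_fps ?Q)) y \<in> moebius_image A B"
    using K[OF y] by simp
qed

end


section \<open>The inclusion\<close>

theorem theorem2p1:
  fixes n p :: nat and lam \<mu> l A B \<sigma> \<delta> :: real
  assumes "n \<ge> 1" and "p \<ge> 1"
    and "lam \<ge> \<mu>" and "\<mu> \<ge> 0" and "l \<ge> 0"
    and "-1 \<le> A" and "A < B" and "B \<le> 1" and "0 < B"
    and "0 \<le> \<sigma>" and "\<sigma> < real p"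
    and "lam - \<mu> \<ge> (l + real p) / (2 * real p) \<or> (lam = 0 \<and> \<mu> = 0)"
    and "\<delta> \<ge> 0"
  shows "class_P n lam \<mu> l (\<delta> + 1) A B \<sigma> p \<subseteq> class_P n lam \<mu> l \<delta> A B \<sigma> p"
proof
  fix f assume fP: "f \<in> class_P n lam \<mu> l (\<delta> + 1) A B \<sigma> p"
  then have fA: "f \<in> class_A n p" by (simp add: class_P_def)
  then interpret J_operator n p lam \<mu> l f
    by unfold_locales (use assms in \<open>auto simp: class_A_def\<close>)
  have B: "\<bar>B\<bar> \<le> 1" using assms by simp
  have "\<forall>z\<in>unit_disc. eval_fps (normalized_fps \<sigma> (\<delta> + 1)) z \<in> moebius_image A B"
  proof (rule subordinate_normalized_iff[THEN iffD1])
    show "subordinate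
          (\<lambda>z. 1 / complex_of_real (real p - \<sigma>) *
               (remove_sings (\<lambda>u. deriv (J_op n p (\<delta> + 1) lam \<mu> l f) u / u ^ (p - 1)) z
                 - complex_of_real \<sigma>))
          (\<lambda>z. (1 + complex_of_real A * z) / (1 + complex_of_real B * z))"
      using fP unfolding class_P_def by blast
  qed (use assms B in auto)
  then have "\<forall>z\<in>unit_disc. eval_fps (normalized_fps \<sigma> \<delta>) z \<in> moebius_image A B"
    using range_in_moebius_image_decrease_parameter[OF \<open>\<delta> \<ge> 0\<close> B] by blast
  then show "f \<in> class_P n lam \<mu> l \<delta> A B \<sigma> p"
    using fA subordinate_normalized_iff[OF \<open>\<delta> \<ge> 0\<close> \<open>\<sigma> < real p\<close> \<open>A < B\<close> B]
    unfolding class_P_def by blast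
qed

end
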